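(* Let $n\ge1$ and $\lambda=(\lambda_1,\ldots,\lambda_n)\in\mathbb{R}^n$ with $0<\lambda_1\le\cdots\le\lambda_n$, and let $\mathfrak{g}_\lambda$ be the associated oscillator Lie algebra. The quadratic dimension of $\mathfrak{g}_\lambda$ is equal to $2$. More precisely, let $B:\mathfrak{g}_\lambda\times\mathfrak{g}_\lambda\to\mathbb{R}$ be a symmetric bilinear invariant form, i.e., $$B([u,v],w)+B(v,[u,w])=0\quad\text{for all }u,v,w\in\mathfrak{g}_\lambda.$$ Then there exist $p,q\in\mathbb{R}$ such that $$B=p\,\mathbf{k}_\lambda+q\,e_{-1}^*\odot e_{-1}^*.$$
   Context: Oscillator Lie algebra: for $n\ge1$ and $\lambda=(\lambda_1,\ldots,\lambda_n)\in\mathbb{R}^n$ with $0<\lambda_1\le\cdots\le\lambda_n$, $\mathfrak{g}_\lambda$ is the real Lie algebra of dimension $2n+2$ with basis $\{e_{-1},e_0,e_i,\check e_i\}_{i=1,\ldots,n}$ and brackets $$[e_{-1},e_i]=\lambda_i\check e_i,\qquad [e_{-1},\check e_i]=-\lambda_i e_i,\qquad [e_i,\check e_i]=e_0,\qquad i=1,\ldots,n,$$ the unspecified brackets of basis elements being given by antisymmetry or zero. $\{e_{-1}^*,e_0^*,e_i^*,\check e_i^*\}$ denotes the dual basis, and $\alpha\odot\beta=\alpha\otimes\beta+\beta\otimes\alpha$. $\mathbf{k}_\lambda$ is the symmetric bilinear form on $\mathfrak{g}_\lambda$ whose quadratic form is $\mathbf{k}_\lambda(x,x)=2x_{-1}x_0+\sum_{j=1}^n\frac1{\lambda_j}(x_j^2+\check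 x_j^2)$ for $x=x_{-1}e_{-1}+x_0e_0+\sum_{i=1}^n(x_ie_i+\check x_i\check e_i)$. Quadratic dimension of a Lie algebra $\mathfrak{g}$: the dimension of the vector space spanned by all non-degenerate invariant symmetric bilinear forms on $\mathfrak{g}$ (invariant in the sense displayed in the claim). *)

theory Defs
  imports "HOL-Analysis.Analysis" "HOL-Library.Function_Algebras"
begin

section \<open>Invariant forms and the quadratic dimension\<close>

definition lie_bracket :: "('a::real_vector \<Rightarrow> 'a \<Rightarrow> 'a) \<Rightarrow> bool" where
  "lie_bracket br \<longleftrightarrow> bilinear br \<and> (\<forall>u. br u u = 0) \<and>
     (\<forall>u v w. br u (br v w) + br v (br w u) + br w (br u v) = 0)"

definition symmetric_bilinear :: "('a::real_vector \<Rightarrow> 'a \<Rightarrow> real) \<Rightarrow> bool" where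
  "symmetric_bilinear B \<longleftrightarrow> bilinear B \<and> (\<forall>u v. B u v = B v u)"

definition invariant_form ::
    "('a::real_vector \<Rightarrow> 'a \<Rightarrow> 'a) \<Rightarrow> ('a \<Rightarrow> 'a \<Rightarrow> real) \<Rightarrow> bool" where
  "invariant_form br B \<longleftrightarrow> (\<forall>u v w. B (br u v) w + B v (br u w) = 0)"

definition nondegenerate :: "('a::real_vector \<Rightarrow> 'a \<Rightarrow> real) \<Rightarrow> bool" where
  "nondegenerate B \<longleftrightarrow> (\<forall>u. (\<forall>v. B u v = 0) \<longrightarrow> u = 0)"

text \<open>
  Functions carry no \<open>real_vector\<close> instance, so the pointwise scaling is passed explicitly to
  the locale constants \<open>module.span\<close> and \<open>vector_space.dim\<close>; the additive structure is the
  pointwise one of \<^theory>\<open>HOL-Library.Function_Algebras\<close>.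
\<close>

definition form_scale :: "real \<Rightarrow> ('a \<Rightarrow> 'a \<Rightarrow> real) \<Rightarrow> 'a \<Rightarrow> 'a \<Rightarrow> real" where
  "form_scale c B = (\<lambda>u v. c * B u v)"

lemma vector_space_form_scale: "vector_space form_scale"
  by unfold_locales (auto simp: form_scale_def fun_eq_iff algebra_simps)

definition quadratic_dimension :: "('a::real_vector \<Rightarrow> 'a \<Rightarrow> 'a) \<Rightarrow> nat" where
  "quadratic_dimension br =
     vector_space.dim form_scale
       (module.span form_scale
          {B. symmetric_bilinear B \<and> invariant_form br B \<and> nondegenerate B})"


section \<open>The oscillator Lie algebra\<close>

text \<open>
  The constructors index the basis vectors \<open>e\<^bsub>-1\<^esub>\<close>, \<open>e\<^sub>0\<close>, \<open>e\<^sub>i\<close> and the checked \<open>e\<^sub>i\<close>, where \<open>i\<close>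
  ranges over a finite linearly ordered type \<open>'n\<close> playing the role of \<open>{1..n}\<close>.
\<close>

datatype 'n osc_idx = Em1 | E0 | E 'n | Ec 'n

lemma UNIV_osc_idx: "(UNIV :: 'n osc_idx set) = {Em1, E0} \<union> range E \<union> range Ec"
  by (auto intro: osc_idx.exhaust)

instance osc_idx :: (finite) finite
  by standard (simp add: UNIV_osc_idx)

type_synonym 'n osc = "real ^ 'n osc_idx"

lemma card_osc_idx: "CARD('n::finite osc_idx) = 2 * CARD('n) + 2"
proof -
  have "card (range E \<union> range Ec :: 'n osc_idx set) = 2 * CARD('n)"
    by (subst card_Un_disjoint) (auto simp: card_image inj_on_def)
  moreover have "card (insert Em1 (insert E0 (range E \<union> range Ec)) :: 'n osc_idx set) =
      Suc (Suc (card (range E \<union> range Ec :: 'n osc_idx set)))"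
    by (subst card_insert_disjoint; auto)+
  ultimately show ?thesis
    by (simp add: UNIV_osc_idx)
qed

definition basis_e :: "'n::finite osc_idx \<Rightarrow> 'n osc" where
  "basis_e a = axis a 1"

fun basis_bracket :: "real ^ 'n \<Rightarrow> 'n::finite osc_idx \<Rightarrow> 'n osc_idx \<Rightarrow> 'n osc" where
  "basis_bracket lam Em1 (E i) = (lam $ i) *\<^sub>R basis_e (Ec i)"
| "basis_bracket lam (E i) Em1 = - ((lam $ i) *\<^sub>R basis_e (Ec i))"
| "basis_bracket lam Em1 (Ec i) = - ((lam $ i) *\<^sub>R basis_e (E i))"
| "basis_bracket lam (Ec i) Em1 = (lam $ i) *\<^sub>R basis_e (E i)"
| "basis_bracket lam (E i) (Ec j) = (if i = j then basis_e E0 else 0)"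
| "basis_bracket lam (Ec i) (E j) = (if i = j then - basis_e E0 else 0)"
| "basis_bracket lam _ _ = 0"

definition osc_bracket :: "real ^ 'n \<Rightarrow> 'n::finite osc \<Rightarrow> 'n osc \<Rightarrow> 'n osc" where
  "osc_bracket lam u v = (\<Sum>a\<in>UNIV. \<Sum>b\<in>UNIV. (u $ a * v $ b) *\<^sub>R basis_bracket lam a b)"

definition dual_e :: "'n::finite osc_idx \<Rightarrow> 'n osc \<Rightarrow> real" where
  "dual_e a = (\<lambda>x. x $ a)"

definition odot :: "('a \<Rightarrow> real) \<Rightarrow> ('a \<Rightarrow> real) \<Rightarrow> 'a \<Rightarrow> 'a \<Rightarrow> real"  (infixl "\<odot>" 70) where
  "\<alpha> \<odot> \<beta> = (\<lambda>u v. \<alpha> u * \<beta> v + \<beta> u * \<alpha> v)"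

definition k_quad :: "real ^ 'n \<Rightarrow> 'n::finite osc \<Rightarrow> real" where
  "k_quad lam x =
     2 * x $ Em1 * x $ E0 + (\<Sum>j\<in>UNIV. 1 / lam $ j * ((x $ E j)\<^sup>2 + (x $ Ec j)\<^sup>2))"

text \<open>
  The symmetric bilinear form with quadratic form \<open>k_quad lam\<close>, obtained by polarization; the
  lemmas below show that it has the defining property and is the only such form.
\<close>

definition k_form :: "real ^ 'n \<Rightarrow> 'n::finite osc \<Rightarrow> 'n osc \<Rightarrow> real" where
  "k_form lam u v = (k_quad lam (u + v) - k_quad lam u - k_quad lam v) / 2"

lemma k_form_eq:
  "k_form lam u v = u $ Em1 * v $ E0 + u $ E0 * v $ Em1 +
     (\<Sum>j\<in>UNIV. 1 / lam $ j * (u $ E j * v $ E j + u $ Ec j * v $ Ec j))"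
proof -
  have "(\<Sum>j\<in>UNIV. 1 / lam $ j * (((u + v) $ E j)\<^sup>2 + ((u + v) $ Ec j)\<^sup>2)) =
     (\<Sum>j\<in>UNIV. 1 / lam $ j * ((u $ E j)\<^sup>2 + (u $ Ec j)\<^sup>2)) +
     (\<Sum>j\<in>UNIV. 1 / lam $ j * ((v $ E j)\<^sup>2 + (v $ Ec j)\<^sup>2)) +
     2 * (\<Sum>j\<in>UNIV. 1 / lam $ j * (u $ E j * v $ E j + u $ Ec j * v $ Ec j))"
    unfolding sum_distrib_left sum.distrib[symmetric]
    by (rule sum.cong) (auto simp: power2_sum algebra_simps add_divide_distrib)
  then show ?thesis
    unfolding k_form_def k_quad_def by (simp add: algebra_simps)
qed

lemma k_form_diag: "k_form lam x x = k_quad lam x"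
  unfolding k_form_eq k_quad_def by (simp add: power2_eq_square)

lemma symmetric_bilinear_k_form: "symmetric_bilinear (k_form lam)"
proof -
  have "k_form lam u v = k_form lam v u" for u v
    unfolding k_form_def by (simp add: add.commute)
  moreover have "linear (k_form lam u)" for u
    by (rule linearI)
      (simp_all add: k_form_eq sum.distrib[symmetric] sum_distrib_left algebra_simps add_divide_distrib)
  ultimately show ?thesis
    unfolding symmetric_bilinear_def bilinear_def by simp
qed

lemma k_form_unique:
  assumes "symmetric_bilinear B" and "\<And>x. B x x = k_quad lam x"
  shows "B = k_form lam"
proof (intro ext)
  fix u v
  have bl: "bilinear B" and sym: "B v u = B u v"
    using assms(1) by (auto simp: symmetric_bilinear_def)
  have "B (u + v) (u + v) = B u u + 2 * B u v + B v v"
    by (simp add: bilinear_ladd[OF bl] bilinear_radd[OF bl] sym)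
  then show "B u v = k_form lam u v"
    unfolding k_form_def assms(2)[symmetric] by simp
qed

lemma sum_osc_idx:
  fixes f :: "'n::finite osc_idx \<Rightarrow> 'a::comm_monoid_add"
  shows "(\<Sum>a\<in>UNIV. f a) = f Em1 + f E0 + (\<Sum>i\<in>UNIV. f (E i)) + (\<Sum>i\<in>UNIV. f (Ec i))"
proof -
  have "(\<Sum>a\<in>UNIV. f a) = sum f {Em1, E0} + sum f (range E) + sum f (range Ec)"
    unfolding UNIV_osc_idx by (subst sum.union_disjoint, auto simp del: Un_insert_left)+
  then show ?thesis
    by (simp add: sum.reindex inj_on_def o_def)
qed

lemma osc_bracket_e: "osc_bracket lam (basis_e a) (basis_e b) = basis_bracket lam a b"
proof -
  have "osc_bracket lam (basis_e a) (basis_e b) =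
      (\<Sum>c\<in>UNIV. \<Sum>d\<in>UNIV. if c = a then if d = b then basis_bracket lam c d else 0 else 0)"
    unfolding osc_bracket_def by (intro sum.cong refl) (simp add: basis_e_def axis_def)
  also have "\<dots> = (\<Sum>c\<in>UNIV. if c = a then (\<Sum>d\<in>UNIV. if d = b then basis_bracket lam c d else 0) else 0)"
    by (intro sum.cong refl) simp
  finally show ?thesis by simp
qed

lemma osc_bracket_nth:
  "osc_bracket lam u v $ Em1 = 0"
  "osc_bracket lam u v $ E0 = (\<Sum>i\<in>UNIV. u $ E i * v $ Ec i - u $ Ec i * v $ E i)"
  "osc_bracket lam u v $ E i = lam $ i * (u $ Ec i * v $ Em1 - u $ Em1 * v $ Ec i)"
  "osc_bracket lam u v $ Ec i = lam $ i * (u $ Em1 * v $ E i - u $ E i * v $ Em1)"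
  unfolding osc_bracket_def
  by (simp_all add: sum_osc_idx basis_e_def axis_def sum.distrib sum_subtractf
        if_distrib[of "\<lambda>x. _ * x"] if_distrib[of uminus] if_distrib[of "\<lambda>x. x $ _"] sum_negf
        algebra_simps cong: if_cong)

lemma lie_bracket_osc_bracket: "lie_bracket (osc_bracket lam)"
proof -
  have ex: "x = y" if "x $ Em1 = y $ Em1" "x $ E0 = y $ E0"
      "\<And>i. x $ E i = y $ E i" "\<And>i. x $ Ec i = y $ Ec i" for x y :: "'n::finite osc"
    unfolding vec_eq_iff using that by (metis osc_idx.exhaust)
  have "bilinear (osc_bracket lam)"
    unfolding bilinear_def
    by (intro conjI allI linearI; rule ex)
      (simp_all add: osc_bracket_nth sum.distrib[symmetric] sum_distrib_left algebra_simps)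
  moreover have "osc_bracket lam u u = 0" for u
    by (rule ex) (simp_all add: osc_bracket_nth)
  moreover have "osc_bracket lam u (osc_bracket lam v w) + osc_bracket lam v (osc_bracket lam w u)
      + osc_bracket lam w (osc_bracket lam u v) = 0" for u v w
    by (rule ex) (simp_all add: osc_bracket_nth sum.distrib[symmetric] algebra_simps)
  ultimately show ?thesis
    unfolding lie_bracket_def by blast
qed

end

theory Submission
  imports Defs
begin

text \<open>
  Every basis vector other than \<open>e\<^bsub>-1\<^esub>\<close> is a multiple of a bracket, so invariance moves each
  value of \<open>B\<close> on basis vectors to zero or a multiple of \<open>B(e\<^bsub>-1\<^esub>, e\<^sub>0)\<close>; only the latter and
  \<open>B(e\<^bsub>-1\<^esub>, e\<^bsub>-1\<^esub>)\<close> are free. Conversely \<open>p k + q e\<^bsub>-1\<^esub>\<^sup>* \<odot> e\<^bsub>-1\<^esub>\<^sup>*\<close> is invariant, and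
  nondegenerate when \<open>p\<close> is nonzero, so the nondegenerate forms with parameters \<open>(1, 0)\<close> and
  \<open>(1, 1)\<close> already span a plane containing all invariant forms.
\<close>

interpretation form: vector_space form_scale
  by (rule vector_space_form_scale)

lemma basis_e_nth: "basis_e a $ b = (if b = a then 1 else 0)"
  by (simp add: basis_e_def axis_def)

definition osc_form :: "real ^ 'n \<Rightarrow> real \<Rightarrow> real \<Rightarrow> 'n::finite osc \<Rightarrow> 'n osc \<Rightarrow> real" where
  "osc_form lam p q = (\<lambda>u v. p * k_form lam u v + q * (dual_e Em1 \<odot> dual_e Em1) u v)"

lemma osc_form_eq:
  "osc_form lam p q u v = p * (u $ Em1 * v $ E0 + u $ E0 * v $ Em1 +
     (\<Sum>j\<in>UNIV. 1 / lam $ j * (u $ E j * v $ E j + u $ Ec j * v $ Ec j))) +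
     2 * q * u $ Em1 * v $ Em1"
  by (simp add: osc_form_def k_form_eq odot_def dual_e_def)

lemma symmetric_bilinear_osc_form: "symmetric_bilinear (osc_form lam p q)"
proof -
  have sym: "osc_form lam p q u v = osc_form lam p q v u" for u v
    by (simp add: osc_form_eq mult.commute add.commute)
  have "linear (k_form lam u)" for u
    using symmetric_bilinear_k_form[of lam] by (auto simp: symmetric_bilinear_def bilinear_def)
  then have "linear (osc_form lam p q u)" for u
    by (intro linearI)
      (simp_all add: osc_form_def odot_def dual_e_def linear_add linear_cmul algebra_simps)
  then show ?thesis
    unfolding symmetric_bilinear_def bilinear_def using sym by simp
qed

lemma osc_form_basis_e:
  "osc_form lam p q (basis_e Em1) v = p * v $ E0 + 2 * q * v $ Em1"
  "osc_form lam p q (basis_e E0) v = p * v $ Em1"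
  "osc_form lam p q (basis_e (E i)) v = p * v $ E i / lam $ i"
  "osc_form lam p q (basis_e (Ec i)) v = p * v $ Ec i / lam $ i"
  by (simp_all add: osc_form_eq basis_e_nth if_distrib[of "\<lambda>x. x * _"]
      if_distrib[of "\<lambda>x. _ * x"] if_distrib[of "\<lambda>x. x / _"] cong: if_cong)

text \<open>The weights \<open>1 / lam $ j\<close> of \<open>k_form\<close> cancel the factors
  \<open>lam $ j\<close> of the bracket, leaving a termwise cancellation. The \<open>q\<close> part
  is invariant because no bracket has an \<open>Em1\<close> coordinate.\<close>

lemma invariant_osc_form:
  assumes "\<And>i. lam $ i \<noteq> 0"
  shows "invariant_form (osc_bracket lam) (osc_form lam p q)"
  unfolding invariant_form_def
proof (intro allI)
  fix u v w
  have "1 / lam $ j * (lam $ j * x * y + lam $ j * z * t) = x * y + z * t" for j x y z t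
    using assms[of j] by (simp add: field_simps)
  then have k: "k_form lam (osc_bracket lam a b) c =
      (\<Sum>j\<in>UNIV. a $ E j * b $ Ec j - a $ Ec j * b $ E j) * c $ Em1 +
      (\<Sum>j\<in>UNIV. (a $ Ec j * b $ Em1 - a $ Em1 * b $ Ec j) * c $ E j +
                  (a $ Em1 * b $ E j - a $ E j * b $ Em1) * c $ Ec j)" for a b c
    by (simp add: k_form_eq osc_bracket_nth)
  \<comment> \<open>Symmetry moves the bracket into the first slot, so that \<open>k\<close> expands
    both summands.\<close>
  have "k_form lam v (osc_bracket lam u w) = k_form lam (osc_bracket lam u w) v"
    using symmetric_bilinear_k_form by (auto simp: symmetric_bilinear_def)
  then have "k_form lam (osc_bracket lam u v) w + k_form lam v (osc_bracket lam u w) = 0"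
    unfolding k
    by (simp add: sum_distrib_right sum.distrib[symmetric])
      (simp add: algebra_simps)
  then show "osc_form lam p q (osc_bracket lam u v) w + osc_form lam p q v (osc_bracket lam u w) = 0"
    by (simp add: osc_form_def odot_def dual_e_def osc_bracket_nth flip: distrib_left)
qed

lemma nondegenerate_osc_form:
  assumes "\<And>i. lam $ i \<noteq> 0" and "p \<noteq> 0"
  shows "nondegenerate (osc_form lam p q)"
  unfolding nondegenerate_def
proof (intro allI impI)
  fix u
  assume u: "\<forall>v. osc_form lam p q u v = 0"
  have z: "osc_form lam p q (basis_e a) u = 0" for a
    using u symmetric_bilinear_osc_form unfolding symmetric_bilinear_def by metis
  \<comment> \<open>Pairing with \<open>basis_e E0\<close> kills the \<open>Em1\<close> coordinate;
    this removes the \<open>q\<close> term from the pairing with \<open>basis_e Em1\<close>, which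
    then kills the \<open>E0\<close> coordinate.\<close>
  have "u $ a = 0" for a
    using z[of a] z[of Em1] z[of E0] assms by (cases a) (auto simp: osc_form_basis_e)
  then show "u = 0"
    by (simp add: vec_eq_iff)
qed

text \<open>The second parameter is halved because \<open>dual_e Em1 \<odot> dual_e Em1\<close>
  takes the value 2, not 1, on the pair (\<open>basis_e Em1\<close>,
  \<open>basis_e Em1\<close>).\<close>

theorem invariant_form_eq_osc_form:
  fixes lam :: "real ^ 'n::finite"
  assumes nz: "\<And>i. lam $ i \<noteq> 0"
    and sb: "symmetric_bilinear B" and inv: "invariant_form (osc_bracket lam) B"
  shows "B = osc_form lam (B (basis_e Em1) (basis_e E0)) (B (basis_e Em1) (basis_e Em1) / 2)"
    (is "B = osc_form lam ?p ?q")
proof -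
  let ?e = "basis_e :: 'n osc_idx \<Rightarrow> 'n osc"
  have bl: "bilinear B" and sym: "B u v = B v u" for u v
    using sb by (auto simp: symmetric_bilinear_def)
  note bl_simps = bilinear_lmul[OF bl] bilinear_rmul[OF bl] bilinear_lneg[OF bl]
    bilinear_rneg[OF bl] bilinear_lzero[OF bl] bilinear_rzero[OF bl]
  have I: "B (basis_bracket lam a b) (?e c) = - B (?e b) (basis_bracket lam a c)" for a b c
    using inv unfolding invariant_form_def
    by (metis osc_bracket_e eq_neg_iff_add_eq_0)
  \<comment> \<open>Up to sign, \<open>?e E0\<close> is the bracket of \<open>?e (E j)\<close> and
    \<open>?e (Ec j)\<close>; in each instance the bracket on the other side is zero.\<close>
  have E0: "B (?e E0) (?e E0) = 0" "B (?e E0) (?e (E j)) = 0" "B (?e E0) (?e (Ec j)) = 0" for j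
    using I[of "E j" "Ec j" E0] I[of "E j" "Ec j" "E j"] I[of "Ec j" "E j" "Ec j"]
    by (simp_all add: bl_simps)
  \<comment> \<open>Here the other side contains the bracket of \<open>?e Em1\<close> with
    itself.\<close>
  have Em1: "B (?e Em1) (?e (E j)) = 0" "B (?e Em1) (?e (Ec j)) = 0" for j
    using I[of Em1 "Ec j" Em1] I[of Em1 "E j" Em1] nz[of j]
    by (simp_all add: bl_simps sym[of "?e (E _)" "?e Em1"] sym[of "?e (Ec _)" "?e Em1"])
  \<comment> \<open>Bracketing \<open>?e (Ec i)\<close> with \<open>?e Em1\<close> gives
    \<open>lam $ i\<close> times \<open>?e (E i)\<close>. Moving \<open>?e (Ec i)\<close> across
    leaves \<open>?e Em1\<close> paired with a bracket that is a multiple of \<open>?e E0\<close>,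
    nonzero only against \<open>?e (E i)\<close>. The other cases are analogous.\<close>
  have E: "B (?e (E i)) (?e (E j)) = (if i = j then ?p / lam $ i else 0)"
    "B (?e (Ec i)) (?e (Ec j)) = (if i = j then ?p / lam $ i else 0)"
    "B (?e (E i)) (?e (Ec j)) = 0" for i j
    using I[of "Ec i" Em1 "E j"] I[of "E i" Em1 "Ec j"] I[of "Ec i" Em1 "Ec j"] nz[of i]
    by (auto simp: bl_simps field_simps split: if_splits)
  have basis: "B (?e a) (?e b) = osc_form lam ?p ?q (?e a) (?e b)" for a b
    by (cases a; cases b)
      (auto simp: osc_form_basis_e E0 Em1 E sym[of "?e E0" "?e Em1"] sym[of "?e (E _)" "?e Em1"]
        sym[of "?e (Ec _)" "?e Em1"] sym[of "?e (E _)" "?e E0"] sym[of "?e (Ec _)" "?e E0"]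
        sym[of "?e (Ec _)" "?e (E _)"] basis_e_nth)
  have "bilinear (osc_form lam ?p ?q)"
    using symmetric_bilinear_osc_form by (auto simp: symmetric_bilinear_def)
  with bl show ?thesis
  proof (rule bilinear_eq_stdbasis)
    fix i j :: "'n osc"
    assume "i \<in> Basis" "j \<in> Basis"
    then obtain a b where "i = ?e a" "j = ?e b"
      by (auto simp: Basis_vec_def basis_e_def)
    then show "B i j = osc_form lam ?p ?q i j"
      using basis by blast
  qed
qed

lemma osc_form_span:
  "osc_form lam p q \<in> form.span {osc_form lam 1 0, osc_form lam 0 1}"
proof -
  have "osc_form lam p q = form_scale p (osc_form lam 1 0) + form_scale q (osc_form lam 0 1)"
    by (simp add: fun_eq_iff form_scale_def osc_form_def)
  then show ?thesis
    by (simp only:) (intro form.span_add form.span_scale form.span_base; simp)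
qed

text \<open>Evaluation at (\<open>Em1\<close>, \<open>E0\<close>) and (\<open>Em1\<close>,
  \<open>Em1\<close>) reads off \<open>p\<close> and \<open>2 * q\<close>.\<close>

lemma independent_osc_forms:
  "form.independent {osc_form lam 1 0, osc_form lam 0 1}" "osc_form lam 1 0 \<noteq> osc_form lam 0 1"
proof -
  have A: "osc_form lam 1 0 (basis_e Em1) (basis_e E0) = 1"
    "osc_form lam 0 1 (basis_e Em1) (basis_e E0) = 0"
    "osc_form lam 0 1 (basis_e Em1) (basis_e Em1) = 2"
    by (simp_all add: osc_form_basis_e basis_e_nth)
  then show "osc_form lam 1 0 \<noteq> osc_form lam 0 1"
    by auto
  have "osc_form lam 1 0 \<noteq> form_scale c (osc_form lam 0 1)" for c
    using A by (metis form_scale_def mult_zero_right zero_neq_one)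
  moreover have "osc_form lam 0 1 \<noteq> 0"
    using A by (metis zero_fun_apply zero_neq_numeral)
  ultimately show "form.independent {osc_form lam 1 0, osc_form lam 0 1}"
    by (auto simp: form.independent_insert form.span_insert)
qed

lemma quadratic_dimension_osc_bracket:
  fixes lam :: "real ^ 'n::finite"
  assumes nz: "\<And>i. lam $ i \<noteq> 0"
  shows "quadratic_dimension (osc_bracket lam) = 2"
proof -
  define S where "S = {B. symmetric_bilinear B \<and> invariant_form (osc_bracket lam) B \<and> nondegenerate B}"
  let ?b = "{osc_form lam 1 0, osc_form lam 0 1}"
  have S: "osc_form lam 1 q \<in> S" for q
    using nz by (simp add: S_def symmetric_bilinear_osc_form invariant_osc_form nondegenerate_osc_form)
  \<comment> \<open>\<open>osc_form lam 0 1\<close> is degenerate, hence not in \<open>S\<close>; it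
    is reached only as a difference of two members of \<open>S\<close>.\<close>
  have "osc_form lam 0 1 = osc_form lam 1 1 - osc_form lam 1 0"
    by (simp add: fun_eq_iff osc_form_def)
  then have "?b \<subseteq> form.span S"
    using S by (auto intro: form.span_base form.span_diff)
  moreover have "S \<subseteq> form.span ?b"
    using invariant_form_eq_osc_form[OF nz] osc_form_span
    unfolding S_def by (metis (lifting) mem_Collect_eq subsetI)
  ultimately have "form.span ?b = form.span S"
    by (simp add: form.span_eq)
  then have "form.dim S = card ?b"
    by (rule form.dim_eq_card) (rule independent_osc_forms)
  then show ?thesis
    using independent_osc_forms(2)[of lam] by (simp add: quadratic_dimension_def flip: S_def)
qed

theorem lemma2p2:
  fixes lam :: "real ^ 'n::{finite,linorder}"
  assumes "\<forall>i. 0 < lam $ i"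
    and "\<forall>i j. i \<le> j \<longrightarrow> lam $ i \<le> lam $ j"
  shows "quadratic_dimension (osc_bracket lam) = 2 \<and>
    (\<forall>B. symmetric_bilinear B \<and> invariant_form (osc_bracket lam) B \<longrightarrow>
      (\<exists>p q. B = (\<lambda>u v. p * k_form lam u v + q * (dual_e Em1 \<odot> dual_e Em1) u v)))"
proof -
  have nz: "lam $ i \<noteq> 0" for i
    using assms(1) by (metis less_irrefl)
  then show ?thesis
    using quadratic_dimension_osc_bracket invariant_form_eq_osc_form
    unfolding osc_form_def[abs_def] by blast
qed

end
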